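(* Let $R$ be a commutative ring with identity and let $S$ be a multiplicatively closed subset of $R$. Suppose that $Nil(R)$ is a prime divided ideal of $R$ with $Nil(R)\cap S=\emptyset$, and let $I$ be a nil ideal of $R$. Then $I$ is $S$-decomposable if and only if $I$ is $S$-primary. In particular, $R$ is $S$-Laskerian if and only if $R$ is nonnil-$S$-Laskerian and every ideal of $R$ contained in $Nil(R)$ is $Nil(R)$-$S$-primary.
   Context: $Nil(R)$ denotes the nilradical of $R$ (the set of nilpotent elements). An ideal $I$ of $R$ is nil if $I\subseteq Nil(R)$, and nonnil if $I\nsubseteq Nil(R)$. An ideal $I$ of $R$ is divided if $I\subset (a)$ for every $a\in R\setminus I$. $rad(Q)$ denotes the radical of an ideal $Q$. A proper ideal $Q$ of $R$ with $Q\cap S=\emptyset$ is $S$-primary if there exists $s\in S$ such that for all $a,b\in R$, if $ab\in Q$ then $sa\in Q$ or $sb\in rad(Q)$; if moreover $rad(Q)=P$, then $Q$ is called $P$-$S$-primary. An ideal $I$ of $R$ with $I\cap S=\emptyset$ is $S$-decomposable if it is a finite intersection of $S$-primary ideals of $R$. $R$ is $S$-Laskerian if every ideal of $R$ disjoint from $S$ is $S$-decomposable; $R$ is nonnil-$S$-Laskerian if every nonnil ideal of $R$ disjoint from $S$ is $S$-decomposable. *)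

theory Defs
  imports "HOL-Algebra.Algebra"
begin

text \<open>Neither \<open>\<one> \<in> S\<close> nor \<open>S \<noteq> {}\<close> is required, so that all the usual conventions for
  multiplicatively closed subsets are covered.\<close>

definition mult_closed :: "('a, 'b) ring_scheme \<Rightarrow> 'a set \<Rightarrow> bool" where
  "mult_closed R S \<longleftrightarrow> S \<subseteq> carrier R \<and> (\<forall>s\<in>S. \<forall>t\<in>S. s \<otimes>\<^bsub>R\<^esub> t \<in> S)"

definition nilradical :: "('a, 'b) ring_scheme \<Rightarrow> 'a set" where
  "nilradical R = {x \<in> carrier R. \<exists>n::nat. n > 0 \<and> x [^]\<^bsub>R\<^esub> n = \<zero>\<^bsub>R\<^esub>}"

definition rad :: "('a, 'b) ring_scheme \<Rightarrow> 'a set \<Rightarrow> 'a set" where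
  "rad R Q = {x \<in> carrier R. \<exists>n::nat. n > 0 \<and> x [^]\<^bsub>R\<^esub> n \<in> Q}"

definition nil_ideal :: "('a, 'b) ring_scheme \<Rightarrow> 'a set \<Rightarrow> bool" where
  "nil_ideal R I \<longleftrightarrow> ideal I R \<and> I \<subseteq> nilradical R"

definition nonnil_ideal :: "('a, 'b) ring_scheme \<Rightarrow> 'a set \<Rightarrow> bool" where
  "nonnil_ideal R I \<longleftrightarrow> ideal I R \<and> \<not> I \<subseteq> nilradical R"

text \<open>Since \<open>a \<in> PIdl a\<close> and \<open>a \<notin> I\<close>, the inclusion below is automatically strict.\<close>

definition divided_ideal :: "('a, 'b) ring_scheme \<Rightarrow> 'a set \<Rightarrow> bool" where
  "divided_ideal R I \<longleftrightarrow> ideal I R \<and> (\<forall>a \<in> carrier R - I. I \<subseteq> PIdl\<^bsub>R\<^esub> a)"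

definition S_primary :: "('a, 'b) ring_scheme \<Rightarrow> 'a set \<Rightarrow> 'a set \<Rightarrow> bool" where
  "S_primary R S Q \<longleftrightarrow>
     ideal Q R \<and> Q \<noteq> carrier R \<and> Q \<inter> S = {} \<and>
     (\<exists>s\<in>S. \<forall>a\<in>carrier R. \<forall>b\<in>carrier R.
        a \<otimes>\<^bsub>R\<^esub> b \<in> Q \<longrightarrow> s \<otimes>\<^bsub>R\<^esub> a \<in> Q \<or> s \<otimes>\<^bsub>R\<^esub> b \<in> rad R Q)"

definition P_S_primary :: "('a, 'b) ring_scheme \<Rightarrow> 'a set \<Rightarrow> 'a set \<Rightarrow> 'a set \<Rightarrow> bool" where
  "P_S_primary R P S Q \<longleftrightarrow> S_primary R S Q \<and> rad R Q = P"

text \<open>The intersection is over a nonempty family.\<close>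

definition S_decomposable :: "('a, 'b) ring_scheme \<Rightarrow> 'a set \<Rightarrow> 'a set \<Rightarrow> bool" where
  "S_decomposable R S I \<longleftrightarrow>
     ideal I R \<and> I \<inter> S = {} \<and>
     (\<exists>\<Q>. finite \<Q> \<and> \<Q> \<noteq> {} \<and> (\<forall>Q\<in>\<Q>. S_primary R S Q) \<and> I = \<Inter>\<Q>)"

definition S_Laskerian :: "('a, 'b) ring_scheme \<Rightarrow> 'a set \<Rightarrow> bool" where
  "S_Laskerian R S \<longleftrightarrow> (\<forall>I. ideal I R \<longrightarrow> I \<inter> S = {} \<longrightarrow> S_decomposable R S I)"

definition nonnil_S_Laskerian :: "('a, 'b) ring_scheme \<Rightarrow> 'a set \<Rightarrow> bool" where
  "nonnil_S_Laskerian R S \<longleftrightarrow>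
     (\<forall>I. nonnil_ideal R I \<longrightarrow> I \<inter> S = {} \<longrightarrow> S_decomposable R S I)"

end

theory Submission
  imports Defs
begin

text \<open>Every \<open>S\<close>-primary component \<open>Q\<close> of a nil ideal either contains the divided prime
  \<open>Nil(R)\<close> or is nil with radical \<open>Nil(R)\<close>. If \<open>a b\<close> lies in the intersection and
  \<open>b \<notin> Nil(R)\<close>, then in the first case \<open>a \<in> Nil(R) \<subseteq> Q\<close> by primality, and in the second
  \<open>s a \<in> Q\<close> for the witness \<open>s\<close> of \<open>Q\<close>, as \<open>s b \<notin> Nil(R)\<close>. The product of the finitely
  many witnesses then shows that the intersection is itself \<open>S\<close>-primary.\<close>

text \<open>\<open>I\<close> is squeezed between \<open>{\<zero>}\<close> and the nilradical, and
  both have the nilradical as radical: exponents multiply for one inclusion,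
  \<open>\<zero> \<in> I\<close> gives the other.\<close>

lemma rad_nil_ideal:
  assumes "cring R" and "nil_ideal R I"
  shows "rad R I = nilradical R"
proof
  interpret cring R by fact
  have I: "ideal I R" "I \<subseteq> nilradical R"
    using assms(2) by (auto simp: nil_ideal_def)
  show "rad R I \<subseteq> nilradical R"
  proof
    fix x assume "x \<in> rad R I"
    then obtain n :: nat where x: "x \<in> carrier R" and n: "n > 0" "x [^]\<^bsub>R\<^esub> n \<in> nilradical R"
      using I by (auto simp: rad_def)
    then obtain m :: nat where "m > 0" "(x [^]\<^bsub>R\<^esub> n) [^]\<^bsub>R\<^esub> m = \<zero>\<^bsub>R\<^esub>"
      by (auto simp: nilradical_def)
    with x n(1) have "n * m > 0" "x [^]\<^bsub>R\<^esub> (n * m) = \<zero>\<^bsub>R\<^esub>"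
      by (simp_all add: nat_pow_pow)
    with x show "x \<in> nilradical R"
      unfolding nilradical_def by blast
  qed
  have "\<zero>\<^bsub>R\<^esub> \<in> I"
    using I(1) by (simp add: additive_subgroup.zero_closed ideal.axioms(1))
  then show "nilradical R \<subseteq> rad R I"
    by (auto simp: nilradical_def rad_def)
qed

text \<open>An element of \<open>Q\<close> outside \<open>P\<close> generates a principal ideal
  lying between \<open>P\<close> and \<open>Q\<close>.\<close>

lemma divided_ideal_comparable:
  assumes "cring R" and "divided_ideal R P" and "ideal Q R"
  shows "Q \<subseteq> P \<or> P \<subseteq> Q"
proof (rule disjCI)
  interpret cring R by fact
  assume "\<not> P \<subseteq> Q"
  show "Q \<subseteq> P"
  proof (rule ccontr)
    assume "\<not> Q \<subseteq> P"
    then obtain a where "a \<in> Q" "a \<notin> P" by blast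
    moreover from this have "a \<in> carrier R"
      using ideal.Icarr[OF assms(3)] by blast
    ultimately have "P \<subseteq> PIdl\<^bsub>R\<^esub> a" "PIdl\<^bsub>R\<^esub> a \<subseteq> Q"
      using assms(2) cgenideal_minimal[OF assms(3)] by (auto simp: divided_ideal_def)
    with \<open>\<not> P \<subseteq> Q\<close> show False by blast
  qed
qed

lemma S_primary_imp_S_decomposable:
  assumes "S_primary R S Q"
  shows "S_decomposable R S Q"
  unfolding S_decomposable_def
  using assms by (intro conjI exI[of _ "{Q}"]) (auto simp: S_primary_def)

text \<open>The condition on \<open>b\<close> refers to the nilradical and not to
  \<open>rad R Q\<close>. It is thus the same for all components, which allows their witnesses to be
  multiplied.\<close>

lemma S_primary_component_witness:
  assumes "cring R" and "mult_closed R S"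
    and prime: "primeideal (nilradical R) R"
    and "divided_ideal R (nilradical R)"
    and disj: "nilradical R \<inter> S = {}"
    and Q: "S_primary R S Q"
  shows "\<exists>s\<in>S. \<forall>a\<in>carrier R. \<forall>b\<in>carrier R.
    a \<otimes>\<^bsub>R\<^esub> b \<in> Q \<inter> nilradical R \<longrightarrow> b \<notin> nilradical R \<longrightarrow> s \<otimes>\<^bsub>R\<^esub> a \<in> Q"
proof -
  interpret cring R by fact
  have idQ: "ideal Q R" using Q by (simp add: S_primary_def)
  have subS: "S \<subseteq> carrier R" using assms(2) by (simp add: mult_closed_def)
  obtain s where s: "s \<in> S" and
    prim: "\<And>a b. \<lbrakk>a \<in> carrier R; b \<in> carrier R; a \<otimes>\<^bsub>R\<^esub> b \<in> Q\<rbrakk>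
      \<Longrightarrow> s \<otimes>\<^bsub>R\<^esub> a \<in> Q \<or> s \<otimes>\<^bsub>R\<^esub> b \<in> rad R Q"
    using Q by (auto simp: S_primary_def)
  have sR: "s \<in> carrier R" and sN: "s \<notin> nilradical R"
    using s subS disj by auto
  have "s \<otimes>\<^bsub>R\<^esub> a \<in> Q"
    if a: "a \<in> carrier R" and b: "b \<in> carrier R" "b \<notin> nilradical R"
      and ab: "a \<otimes>\<^bsub>R\<^esub> b \<in> Q" "a \<otimes>\<^bsub>R\<^esub> b \<in> nilradical R" for a b
    using divided_ideal_comparable[OF \<open>cring R\<close> assms(4) idQ]
  proof
    assume "Q \<subseteq> nilradical R"
    then have "rad R Q = nilradical R"
      using rad_nil_ideal[OF \<open>cring R\<close>] idQ by (simp add: nil_ideal_def)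
    \<comment> \<open>The radical alternative would put \<open>s \<otimes> b\<close> into the prime
      nilradical, which contains neither \<open>s\<close> nor \<open>b\<close>.\<close>
    then show ?thesis
      using prim[OF a b(1) ab(1)] primeideal.I_prime[OF prime sR b(1)] sN b(2) by blast
  next
    assume "nilradical R \<subseteq> Q"
    moreover have "a \<in> nilradical R"
      using primeideal.I_prime[OF prime a b(1) ab(2)] b(2) by blast
    ultimately show ?thesis
      using ideal.I_l_closed[OF idQ _ sR] by blast
  qed
  with s show ?thesis by blast
qed

lemma S_decomposable_nil_imp_S_primary:
  assumes "cring R" and S: "mult_closed R S"
    and prime: "primeideal (nilradical R) R"
    and div: "divided_ideal R (nilradical R)"
    and disj: "nilradical R \<inter> S = {}"
    and nil: "nil_ideal R I" and dec: "S_decomposable R S I"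
  shows "S_primary R S I"
proof -
  interpret cring R by fact
  let ?N = "nilradical R"
  have I: "ideal I R" "I \<subseteq> ?N" and idN: "ideal ?N R"
    using nil prime by (auto simp: nil_ideal_def primeideal.axioms(1))
  have subS: "S \<subseteq> carrier R" and mS: "\<And>s t. \<lbrakk>s \<in> S; t \<in> S\<rbrakk> \<Longrightarrow> s \<otimes>\<^bsub>R\<^esub> t \<in> S"
    using S by (auto simp: mult_closed_def)
  obtain \<Q> where fin: "finite \<Q>" and ne: "\<Q> \<noteq> {}"
    and prim: "\<And>Q. Q \<in> \<Q> \<Longrightarrow> S_primary R S Q" and I_eq: "I = \<Inter>\<Q>"
    using dec by (auto simp: S_decomposable_def)
  \<comment> \<open>Only the conclusion ranges over the subfamily \<open>F\<close>; the premise on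
    \<open>a \<otimes> b\<close> keeps the full intersection \<open>I\<close>. The induction starts
    at singletons, since \<open>S\<close> is not assumed to contain \<open>\<one>\<close> as an
    empty product.\<close>
  have "\<exists>s\<in>S. \<forall>Q\<in>F. \<forall>a\<in>carrier R. \<forall>b\<in>carrier R. a \<otimes>\<^bsub>R\<^esub> b \<in> I \<longrightarrow> b \<notin> ?N \<longrightarrow> s \<otimes>\<^bsub>R\<^esub> a \<in> Q"
    if "finite F" "F \<noteq> {}" "F \<subseteq> \<Q>" for F
    using that
  proof (induction F rule: finite_ne_induct)
    case (singleton Q)
    then show ?case
      using S_primary_component_witness[OF \<open>cring R\<close> S prime div disj prim, of Q] I I_eq by blast
  next
    case (insert Q F)
    obtain s where s: "s \<in> S"
      "\<And>a b. \<lbrakk>a \<in> carrier R; b \<in> carrier R; a \<otimes>\<^bsub>R\<^esub> b \<in> I; b \<notin> ?N\<rbrakk> \<Longrightarrow> s \<otimes>\<^bsub>R\<^esub> a \<in> Q"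
      using S_primary_component_witness[OF \<open>cring R\<close> S prime div disj prim, of Q] I I_eq
        insert.prems by blast
    obtain t where t: "t \<in> S"
      "\<And>a b Q'. \<lbrakk>Q' \<in> F; a \<in> carrier R; b \<in> carrier R; a \<otimes>\<^bsub>R\<^esub> b \<in> I; b \<notin> ?N\<rbrakk> \<Longrightarrow> t \<otimes>\<^bsub>R\<^esub> a \<in> Q'"
      using insert.IH insert.prems by blast
    have st: "s \<in> carrier R" "t \<in> carrier R" using s t subS by auto
    \<comment> \<open>One factor is a witness for \<open>Q'\<close>; the ideal \<open>Q'\<close>
      absorbs the other.\<close>
    have "s \<otimes>\<^bsub>R\<^esub> t \<otimes>\<^bsub>R\<^esub> a \<in> Q'"
      if Q': "Q' \<in> insert Q F" and a: "a \<in> carrier R" and b: "b \<in> carrier R"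
        and ab: "a \<otimes>\<^bsub>R\<^esub> b \<in> I" "b \<notin> ?N" for Q' a b
    proof -
      have idQ': "ideal Q' R"
        using prim Q' insert.prems by (auto simp: S_primary_def)
      consider "Q' = Q" | "Q' \<in> F" using Q' by blast
      then show ?thesis
      proof cases
        case 1
        then have "t \<otimes>\<^bsub>R\<^esub> (s \<otimes>\<^bsub>R\<^esub> a) \<in> Q'"
          using ideal.I_l_closed[OF idQ' _ st(2)] s(2)[OF a b ab] by blast
        then show ?thesis using st a by (simp add: m_ac)
      next
        case 2
        then have "s \<otimes>\<^bsub>R\<^esub> (t \<otimes>\<^bsub>R\<^esub> a) \<in> Q'"
          using ideal.I_l_closed[OF idQ' _ st(1)] t(2)[OF _ a b ab] by blast
        then show ?thesis using st a by (simp add: m_assoc)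
      qed
    qed
    then show ?case using mS[OF s(1) t(1)] by blast
  qed
  \<comment> \<open>For \<open>F\<close> the whole family, lying in every component means lying in
    \<open>I\<close>.\<close>
  from this[OF fin ne subset_refl] obtain s where s: "s \<in> S" and
    w: "\<And>a b. \<lbrakk>a \<in> carrier R; b \<in> carrier R; a \<otimes>\<^bsub>R\<^esub> b \<in> I; b \<notin> ?N\<rbrakk> \<Longrightarrow> s \<otimes>\<^bsub>R\<^esub> a \<in> I"
    unfolding I_eq by blast
  \<comment> \<open>For nilpotent \<open>b\<close> the radical alternative of
    \<open>S_primary\<close> holds, as \<open>rad R I\<close> is the ideal \<open>?N\<close>; for
    all other \<open>b\<close> the fact \<open>w\<close> gives the first alternative.\<close>
  have "s \<otimes>\<^bsub>R\<^esub> b \<in> rad R I" if "b \<in> ?N" for b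
    using ideal.I_l_closed[OF idN that] s subS rad_nil_ideal[OF \<open>cring R\<close> nil] by blast
  moreover have "I \<noteq> carrier R"
    using I(2) primeideal.I_notcarr[OF prime] ideal.Icarr[OF idN] by blast
  ultimately show ?thesis
    unfolding S_primary_def using I disj s w by blast
qed

theorem proposition2p11:
  fixes R :: "('a, 'b) ring_scheme" and S :: "'a set"
  assumes "cring R"
    and "mult_closed R S"
    and "primeideal (nilradical R) R"
    and "divided_ideal R (nilradical R)"
    and "nilradical R \<inter> S = {}"
  shows "(\<forall>I. nil_ideal R I \<longrightarrow> (S_decomposable R S I \<longleftrightarrow> S_primary R S I)) \<and>
    (S_Laskerian R S \<longleftrightarrow>
      nonnil_S_Laskerian R S \<and>
      (\<forall>I. ideal I R \<and> I \<subseteq> nilradical R \<longrightarrow> P_S_primary R (nilradical R) S I))"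
proof -
  have iff: "S_decomposable R S I \<longleftrightarrow> S_primary R S I" if "nil_ideal R I" for I
    using S_decomposable_nil_imp_S_primary[OF assms that] S_primary_imp_S_decomposable by blast
  \<comment> \<open>The prescribed radical is no extra condition, since every nil ideal has radical
    \<open>nilradical R\<close>.\<close>
  have P: "P_S_primary R (nilradical R) S I \<longleftrightarrow> S_decomposable R S I" if "nil_ideal R I" for I
    using iff[OF that] rad_nil_ideal[OF assms(1) that] by (simp add: P_S_primary_def)
  \<comment> \<open>Nil ideals thus all fall under \<open>S_Laskerian\<close>, whose condition
    splits into its nonnil and nil instances.\<close>
  have "I \<inter> S = {}" if "nil_ideal R I" for I
    using that assms(5) by (auto simp: nil_ideal_def)
  then have "S_Laskerian R S \<longleftrightarrow> nonnil_S_Laskerian R S \<and>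
      (\<forall>I. nil_ideal R I \<longrightarrow> S_decomposable R S I)"
    unfolding S_Laskerian_def nonnil_S_Laskerian_def nonnil_ideal_def nil_ideal_def by blast
  with iff P show ?thesis
    unfolding nil_ideal_def by blast
qed

end
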